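(* There exist an absolute constant $c>0$ and, for arbitrarily large $n$, an $n$-point quasimetric space $M$ and a number $r>0$ such that every distribution over $r$-bounded quasipartitions of $M$ that is $\beta$-Lipschitz satisfies $\beta\ge c\,\frac{n^{1/7}}{\log^{4/7} n}$. (In the paper's notation: any such distribution is $\Omega(n^{1/7}/\log^{4/7}n)$-Lipschitz.)
   Context: A quasimetric space is a pair $(X,d)$ with $d:X\times X\to\mathbb{R}_{\ge 0}\cup\{+\infty\}$, $d(x,y)=0$ iff $x=y$, and $d(x,y)\le d(x,z)+d(z,y)$ (no symmetry required). A quasipartition of $X$ is a reflexive and transitive relation $P\subseteq X\times X$; it is $r$-bounded if $(x,y)\in P$ implies $d(x,y)\le r$. A distribution $\mathcal{D}$ over $r$-bounded quasipartitions is $\beta$-Lipschitz if $\Pr_{P\sim\mathcal{D}}[(x,y)\notin P]\le\beta\,d(x,y)/r$ for all $x,y\in X$. *)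

theory Defs
  imports "HOL-Probability.Probability"
begin

text \<open>Nonnegativity of \<open>d\<close>, and the admissibility of the value \<open>\<infinity>\<close>, are part of the type
  \<^typ>\<open>ennreal\<close>.\<close>

locale quasimetric_space =
  fixes M :: "'a set" and d :: "'a \<Rightarrow> 'a \<Rightarrow> ennreal"
  assumes zero: "\<lbrakk>x \<in> M; y \<in> M\<rbrakk> \<Longrightarrow> d x y = 0 \<longleftrightarrow> x = y"
    and triangle: "\<lbrakk>x \<in> M; y \<in> M; z \<in> M\<rbrakk> \<Longrightarrow> d x y \<le> d x z + d z y"

text \<open>The inclusion is stated separately because \<^const>\<open>refl_on\<close> does not imply it.\<close>

definition quasipartition :: "'a set \<Rightarrow> ('a \<times> 'a) set \<Rightarrow> bool" where
  "quasipartition M P \<longleftrightarrow> P \<subseteq> M \<times> M \<and> refl_on M P \<and> trans P"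

definition bounded_relation :: "('a \<Rightarrow> 'a \<Rightarrow> ennreal) \<Rightarrow> real \<Rightarrow> ('a \<times> 'a) set \<Rightarrow> bool" where
  "bounded_relation d r P \<longleftrightarrow> (\<forall>(x, y) \<in> P. d x y \<le> ennreal r)"

text \<open>On a finite \<open>M\<close> there are only finitely many quasipartitions, so every probability
  distribution over them is a \<open>pmf\<close>.\<close>

definition quasipartition_distribution ::
    "'a set \<Rightarrow> ('a \<Rightarrow> 'a \<Rightarrow> ennreal) \<Rightarrow> real \<Rightarrow> ('a \<times> 'a) set pmf \<Rightarrow> bool" where
  "quasipartition_distribution M d r D \<longleftrightarrow>
     (\<forall>P \<in> set_pmf D. quasipartition M P \<and> bounded_relation d r P)"

text \<open>Meant for \<open>\<beta> \<ge> 0\<close> and \<open>r > 0\<close>, as \<^const>\<open>ennreal\<close> sends negative reals to \<open>0\<close>. For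
  \<open>\<beta> > 0\<close> the condition is void at pairs with \<open>d x y = \<infinity>\<close>; for \<open>\<beta> = 0\<close> the convention
  \<open>0 * \<infinity> = 0\<close> applies.\<close>

definition lipschitz_distribution ::
    "'a set \<Rightarrow> ('a \<Rightarrow> 'a \<Rightarrow> ennreal) \<Rightarrow> real \<Rightarrow> real \<Rightarrow> ('a \<times> 'a) set pmf \<Rightarrow> bool" where
  "lipschitz_distribution M d r \<beta> D \<longleftrightarrow>
     (\<forall>x \<in> M. \<forall>y \<in> M.
        ennreal (measure_pmf.prob D {P. (x, y) \<notin> P}) \<le> ennreal \<beta> * d x y / ennreal r)"

end

theory Submission
  imports Defs
begin

text \<open>Take layers \<open>0, \<dots>, T - 1\<close> of grid points \<open>(x, y)\<close>, each with \<open>b\<close> copies, and the lines that move by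
  \<open>(u, u\<^sup>2)\<close> per layer, for \<open>u < q\<close>. Each line gives each of its vertices a label below \<open>N\<close>, and a
  vertex is joined to the later vertices of the line whose label is larger by one. By strict convexity
  a walk that leaves a line never returns to it, so going from label \<open>0\<close> to label \<open>N - 1\<close> of a line
  passes at least \<open>N\<close> vertices. If the labels are random, a fixed set containing a small constant
  fraction of the vertices fails to disconnect a fixed line that it meets sparsely, except with
  probability \<open>4 ^ (- N)\<close>: scanning the layers, order \<open>N\<close> copies outside the set in a layer contain the next label
  with constant probability, and there are several times \<open>N\<close> layers. With \<open>T\<close>, \<open>b\<close>, \<open>q\<close> of order \<open>N\<close>
  a union bound over all such sets yields labels for which every \<open>N\<close>-bounded quasipartition cuts a
  constant fraction of the vertices. Hence \<open>\<beta>\<close> is of order \<open>N\<close>, while there are of order \<open>N\<^sup>7\<close>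
  points.\<close>

subsection \<open>Increasing chains of labels\<close>

text \<open>A labeling \<open>J t i\<close> of the positions \<open>(t, i)\<close> of one line has labels \<open>0, \<dots>, k - 1\<close> in this order on
  layers increasing below \<open>T\<close>, avoiding the positions in \<open>F\<close>.\<close>

primrec chain :: "(nat \<Rightarrow> nat \<Rightarrow> nat) \<Rightarrow> (nat \<times> nat) set \<Rightarrow> nat \<Rightarrow> nat \<Rightarrow> nat \<Rightarrow> bool" where
  "chain J F b 0 T \<longleftrightarrow> True"
| "chain J F b (Suc k) T \<longleftrightarrow> (\<exists>t<T. \<exists>i<b. (t, i) \<notin> F \<and> J t i = k \<and> chain J F b k t)"

lemma chain_mono: "chain J F b k T \<Longrightarrow> T \<le> T' \<Longrightarrow> chain J F b k T'"
  by (cases k) (auto intro: less_le_trans)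

lemma chain_cong:
  assumes "\<And>t. t < T \<Longrightarrow> J t = J' t"
  shows "chain J F b k T \<longleftrightarrow> chain J' F b k T"
  using assms
proof (induction k arbitrary: T)
  case (Suc k)
  have "chain J F b k t \<longleftrightarrow> chain J' F b k t" if "t < T" for t
    using Suc.IH[of t] Suc.prems that by auto
  moreover have "J t i = J' t i" if "t < T" for t i using Suc.prems that by simp
  ultimately show ?case unfolding chain.simps by (metis (no_types))
qed simp

text \<open>Curried by layers, so that an induction on \<open>T\<close> can split off the top layer
  as one row; extensionality keeps the set finite.\<close>

definition labelings :: "nat \<Rightarrow> nat \<Rightarrow> nat \<Rightarrow> (nat \<Rightarrow> nat \<Rightarrow> nat) set" where
  "labelings N b T = ({..<T} \<rightarrow>\<^sub>E ({..<b} \<rightarrow>\<^sub>E {..<N}))"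

definition chainless :: "nat \<Rightarrow> nat \<Rightarrow> (nat \<times> nat) set \<Rightarrow> nat \<Rightarrow> nat \<Rightarrow> (nat \<Rightarrow> nat \<Rightarrow> nat) set" where
  "chainless N b F k T = {J \<in> labelings N b T. \<not> chain J F b k T}"

lemma finite_labelings [simp]: "finite (labelings N b T)"
  unfolding labelings_def by (intro finite_PiE) auto

lemma finite_chainless [simp]: "finite (chainless N b F k T)"
  unfolding chainless_def by simp

lemma card_labelings: "card (labelings N b T) = N ^ (b * T)"
  unfolding labelings_def by (simp add: card_PiE power_mult)

text \<open>Each position outside \<open>B\<close> independently loses one of its \<open>N\<close>
  values, so the fraction of such rows is exactly the power in the hypothesis.\<close>

lemma card_missing_label:
  assumes "k < N" "(1 - 1 / real N) ^ card {i. i < b \<and> i \<notin> B} \<le> \<rho>"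
  shows "real (card {y \<in> {..<b} \<rightarrow>\<^sub>E {..<N}. \<forall>i<b. i \<notin> B \<longrightarrow> y i \<noteq> k}) \<le> \<rho> * real (N ^ b)"
proof -
  let ?C = "{i. i < b \<and> i \<notin> B}"
  have eq: "{y \<in> {..<b} \<rightarrow>\<^sub>E {..<N}. \<forall>i<b. i \<notin> B \<longrightarrow> y i \<noteq> k}
      = PiE {..<b} (\<lambda>i. if i \<in> ?C then {..<N} - {k} else {..<N})"
  proof (intro subset_antisym subsetI)
    fix y assume "y \<in> {y \<in> {..<b} \<rightarrow>\<^sub>E {..<N}. \<forall>i<b. i \<notin> B \<longrightarrow> y i \<noteq> k}"
    then show "y \<in> PiE {..<b} (\<lambda>i. if i \<in> ?C then {..<N} - {k} else {..<N})"
      unfolding PiE_iff by simp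
  next
    fix y assume y: "y \<in> PiE {..<b} (\<lambda>i. if i \<in> ?C then {..<N} - {k} else {..<N})"
    have *: "y i \<in> (if i \<in> ?C then {..<N} - {k} else {..<N})" if "i < b" for i
      using y that unfolding PiE_iff by auto
    have "y i < N" "i \<notin> B \<Longrightarrow> y i \<noteq> k" if "i < b" for i
      using *[OF that] that by (auto split: if_splits)
    then show "y \<in> {y \<in> {..<b} \<rightarrow>\<^sub>E {..<N}. \<forall>i<b. i \<notin> B \<longrightarrow> y i \<noteq> k}"
      using y unfolding PiE_iff by simp
  qed
  have "real (card {y \<in> {..<b} \<rightarrow>\<^sub>E {..<N}. \<forall>i<b. i \<notin> B \<longrightarrow> y i \<noteq> k})
      = (\<Prod>i<b. real N * (if i \<in> ?C then 1 - 1 / real N else 1))"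
    unfolding eq using assms(1)
    by (simp add: card_PiE, intro prod.cong) (auto simp: of_nat_diff field_simps)
  also have "\<dots> = real N ^ b * (\<Prod>i<b. if i \<in> ?C then 1 - 1 / real N else 1)"
    by (simp add: prod.distrib)
  also have "(\<Prod>i<b. if i \<in> ?C then 1 - 1 / real N else 1) = (1 - 1 / real N) ^ card ?C"
  proof -
    have "{..<b} \<inter> {i. i \<in> ?C} = ?C" by auto
    then show ?thesis by (subst prod.If_cases) (auto simp del: mem_Collect_eq)
  qed
  finally show ?thesis using mult_right_mono[OF assms(2), of "real N ^ b"] by (simp add: mult.commute)
qed

text \<open>Removing the top layer keeps a labeling without a chain of length \<open>k\<close> in
  this state. If the layer is in \<open>S\<close>, moreover, either no chain of length
  \<open>k - 1\<close> exists below it, or its row misses the label \<open>k - 1\<close>, which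
  happens for a fraction of at most \<open>\<rho>\<close>. Both cases contribute a factor
  \<open>\<rho>\<close> to the bound, hence \<open>2 * \<rho>\<close> per layer of
  \<open>S\<close>.\<close>

lemma card_chainless:
  assumes "0 < \<rho>" "\<rho> \<le> 1" "k \<le> N"
    and "\<And>t. t \<in> S \<Longrightarrow> (1 - 1 / real N) ^ card {i. i < b \<and> (t, i) \<notin> F} \<le> \<rho>"
  shows "real (card (chainless N b F k T))
    \<le> real (N ^ (b * T)) * (2 * \<rho>) ^ card {t \<in> S. t < T} / \<rho> ^ k"
  using \<open>k \<le> N\<close>
proof (induction T arbitrary: k)
  case 0
  show ?case
  proof (cases k)
    case (Suc k')
    have "card (chainless N b F k 0) \<le> card (labelings N b 0)"
      by (intro card_mono) (auto simp: chainless_def)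
    moreover have "1 \<le> 1 / \<rho> ^ k"
      using assms by (simp add: power_le_one)
    ultimately show ?thesis by (simp add: card_labelings)
  qed (simp add: chainless_def)
next
  case (Suc T)
  show ?case
  proof (cases k)
    case 0
    then show ?thesis using assms by (simp add: chainless_def)
  next
    case k: (Suc k')
    let ?L = "{..<b} \<rightarrow>\<^sub>E {..<N}"
    let ?miss = "{y \<in> ?L. \<forall>i<b. i \<notin> {i. (T, i) \<in> F} \<longrightarrow> y i \<noteq> k'}"
    let ?upd = "\<lambda>(y, J). J(T := y) :: nat \<Rightarrow> nat \<Rightarrow> nat"
    have finL: "finite ?L" by (intro finite_PiE) auto
    \<comment> \<open>Chains below \<open>T\<close> do not see the row \<open>y\<close>. The two
      lengths \<open>j\<close> and \<open>l\<close> allow \<open>k\<close> and \<open>k'\<close> to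
      share one decomposition.\<close>
    have split: "\<exists>y J'. J = ?upd (y, J') \<and> y \<in> ?L \<and> J' \<in> labelings N b T \<and>
        (chain J F b j T \<longleftrightarrow> chain J' F b j T) \<and> (chain J F b l T \<longleftrightarrow> chain J' F b l T)"
      if J: "J \<in> labelings N b (Suc T)" for J j l
    proof -
      obtain y J' where "J = J'(T := y)" "y \<in> ?L" "J' \<in> labelings N b T"
        using J unfolding labelings_def lessThan_Suc PiE_insert_eq by auto
      moreover from this have "chain J F b l T \<longleftrightarrow> chain J' F b l T" for l
        by (intro chain_cong) auto
      ultimately show ?thesis by auto
    qed
    have sub1: "chainless N b F k (Suc T) \<subseteq> ?upd ` (?L \<times> chainless N b F k T)"
    proof
      fix J assume J: "J \<in> chainless N b F k (Suc T)"
      then obtain y J' where *: "J = ?upd (y, J')" "y \<in> ?L" "J' \<in> labelings N b T"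
          "chain J F b k T \<longleftrightarrow> chain J' F b k T"
        using split[of J k k] unfolding chainless_def by blast
      have "\<not> chain J F b k T"
        using J chain_mono[of J F b k T "Suc T"] unfolding chainless_def by auto
      then show "J \<in> ?upd ` (?L \<times> chainless N b F k T)"
        using * unfolding chainless_def by (intro image_eqI[of _ _ "(y, J')"]) auto
    qed
    have sub2: "chainless N b F k (Suc T)
        \<subseteq> ?upd ` (?L \<times> chainless N b F k' T \<union> ?miss \<times> chainless N b F k T)"
    proof
      fix J assume J: "J \<in> chainless N b F k (Suc T)"
      then obtain y J' where *: "J = ?upd (y, J')" "y \<in> ?L" "J' \<in> labelings N b T"
          "chain J F b k T \<longleftrightarrow> chain J' F b k T" "chain J F b k' T \<longleftrightarrow> chain J' F b k' T"
        using split[of J k k'] unfolding chainless_def by blast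
      have n: "\<not> chain J F b k (Suc T)" using J unfolding chainless_def by auto
      have "\<not> chain J F b k T" using n chain_mono[of J F b k T "Suc T"] by auto
      then have 1: "J' \<in> chainless N b F k T" using * unfolding chainless_def by auto
      have "y \<in> ?miss" if "chain J' F b k' T"
      proof -
        have "J T i \<noteq> k'" if "i < b" "(T, i) \<notin> F" for i
          using n that \<open>chain J' F b k' T\<close> *(5) unfolding k by auto
        then show ?thesis using * by auto
      qed
      then have "(y, J') \<in> ?L \<times> chainless N b F k' T \<union> ?miss \<times> chainless N b F k T"
        using 1 * unfolding chainless_def by auto
      then show "J \<in> ?upd ` (?L \<times> chainless N b F k' T \<union> ?miss \<times> chainless N b F k T)"
        using *(1) by blast
    qed
    have cL: "card ?L = N ^ b" by (simp add: card_PiE)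
    let ?A = "real (N ^ (b * T))" and ?e = "(2 * \<rho>) ^ card {t \<in> S. t < T}"
    have IH: "real (card (chainless N b F j T)) \<le> ?A * ?e / \<rho> ^ j" if "j \<le> N" for j
      using Suc.IH[of j] that by simp
    have pw: "real (N ^ (b * Suc T)) = real (N ^ b) * ?A"
      by (simp add: power_add)
    show ?thesis
    proof (cases "T \<in> S")
      case False
      then have "{t \<in> S. t < Suc T} = {t \<in> S. t < T}" by (auto simp: less_Suc_eq)
      moreover have "card (chainless N b F k (Suc T)) \<le> card (?L \<times> chainless N b F k T)"
        by (rule surj_card_le[OF _ sub1]) (use finL in auto)
      then have "real (card (chainless N b F k (Suc T))) \<le> real (N ^ b) * real (card (chainless N b F k T))"
        unfolding card_cartesian_product cL of_nat_mult[symmetric] of_nat_le_iff .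
      moreover have "\<dots> \<le> real (N ^ b) * (?A * ?e / \<rho> ^ k)"
        by (intro mult_left_mono IH Suc.prems) auto
      ultimately show ?thesis unfolding pw by (simp add: mult.assoc)
    next
      case True
      then have "{t \<in> S. t < Suc T} = insert T {t \<in> S. t < T}" by (auto simp: less_Suc_eq)
      then have e: "card {t \<in> S. t < Suc T} = Suc (card {t \<in> S. t < T})" by simp
      have fm: "finite ?miss" using finL by simp
      have "card (chainless N b F k (Suc T))
          \<le> card (?L \<times> chainless N b F k' T \<union> ?miss \<times> chainless N b F k T)"
        by (rule surj_card_le[OF _ sub2]) (use finL fm in auto)
      also have "\<dots> \<le> N ^ b * card (chainless N b F k' T) + card ?miss * card (chainless N b F k T)"
        by (rule order_trans[OF card_Un_le]) (simp add: card_cartesian_product cL)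
      finally have "real (card (chainless N b F k (Suc T)))
          \<le> real (N ^ b) * real (card (chainless N b F k' T)) + real (card ?miss) * real (card (chainless N b F k T))"
        unfolding of_nat_mult[symmetric] of_nat_add[symmetric] of_nat_le_iff .
      also have "\<dots> \<le> real (N ^ b) * (?A * ?e / \<rho> ^ k') + (\<rho> * real (N ^ b)) * (?A * ?e / \<rho> ^ k)"
      proof (intro add_mono mult_left_mono mult_mono)
        show "real (card ?miss) \<le> \<rho> * real (N ^ b)"
          by (rule card_missing_label) (use assms(4)[OF True] Suc.prems k in auto)
        show "real (card (chainless N b F k' T)) \<le> ?A * ?e / \<rho> ^ k'"
          using Suc.prems k by (intro IH) simp
        show "real (card (chainless N b F k T)) \<le> ?A * ?e / \<rho> ^ k"
          using Suc.prems by (rule IH)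
      qed (use assms(1) in auto)
      \<comment> \<open>The first summand also carries a factor \<open>\<rho>\<close>, since
        \<open>1 / \<rho> ^ k' = \<rho> / \<rho> ^ k\<close>.\<close>
      also have "\<dots> = real (N ^ b) * ?A * (2 * \<rho>) ^ Suc (card {t \<in> S. t < T}) / \<rho> ^ k"
        using assms(1) unfolding k by (simp add: field_simps)
      finally show ?thesis unfolding pw e .
    qed
  qed
qed

subsection \<open>Lines and robust labelings\<close>

type_synonym line = "nat \<times> nat \<times> nat"
type_synonym vertex = "nat \<times> nat \<times> nat \<times> nat"

text \<open>A line \<open>(x, y, u)\<close> starts at \<open>(x, y)\<close> in layer \<open>0\<close> and moves by \<open>(u, u\<^sup>2)\<close> per layer; the last
  component of a vertex numbers the \<open>b\<close> copies of each grid point.\<close>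

definition pt :: "line \<Rightarrow> nat \<Rightarrow> nat \<Rightarrow> vertex" where
  "pt = (\<lambda>(x, y, u) t i. (t, x + t * u, y + t * u\<^sup>2, i))"

definition lines :: "nat \<Rightarrow> nat \<Rightarrow> line set" where
  "lines T q = {..<T * q} \<times> {..<T * q\<^sup>2} \<times> {..<q}"

text \<open>The starting region of \<open>lines\<close> is doubled in both directions, so that no
  line leaves the box within \<open>T\<close> layers.\<close>

definition vertices :: "nat \<Rightarrow> nat \<Rightarrow> nat \<Rightarrow> vertex set" where
  "vertices T q b = {..<T} \<times> {..<2 * T * q} \<times> {..<2 * T * q\<^sup>2} \<times> {..<b}"

definition line_trace :: "vertex set \<Rightarrow> line \<Rightarrow> (nat \<times> nat) set" where
  "line_trace F a = {(t, i). pt a t i \<in> F}"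

lemma finite_vertices [simp]: "finite (vertices T q b)"
  unfolding vertices_def by simp

lemma finite_lines [simp]: "finite (lines T q)"
  unfolding lines_def by simp

lemma card_vertices: "card (vertices T q b) = 4 * T ^ 3 * q ^ 3 * b"
  unfolding vertices_def by (simp add: card_cartesian_product power2_eq_square power3_eq_cube)

lemma card_lines: "card (lines T q) = T\<^sup>2 * q ^ 4"
  unfolding lines_def by (simp add: card_cartesian_product power2_eq_square eval_nat_numeral)

section \<open>Incidences between lines and sets of vertices\<close>

lemma pt_in_vertices:
  assumes "a \<in> lines T q"
  shows "pt a t i \<in> vertices T q b \<longleftrightarrow> t < T \<and> i < b"
proof -
  obtain x y u where a: "a = (x, y, u)" by (cases a)
  have *: "x < T * q" "y < T * q\<^sup>2" "u < q" using assms by (auto simp: a lines_def)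
  have "x + t * u < 2 * T * q" "y + t * u\<^sup>2 < 2 * T * q\<^sup>2" if "t < T"
  proof -
    have "t * u \<le> T * q" "t * u\<^sup>2 \<le> T * q\<^sup>2" using * that by (auto intro!: mult_le_mono power_mono)
    then show "x + t * u < 2 * T * q" "y + t * u\<^sup>2 < 2 * T * q\<^sup>2" using * by auto
  qed
  then show ?thesis by (auto simp: a pt_def vertices_def)
qed

lemma line_trace_subset:
  assumes "F \<subseteq> vertices T q b" "a \<in> lines T q"
  shows "line_trace F a \<subseteq> {..<T} \<times> {..<b}"
proof
  fix p assume "p \<in> line_trace F a"
  then obtain t i where "p = (t, i)" "pt a t i \<in> vertices T q b"
    using assms(1) unfolding line_trace_def by auto
  then show "p \<in> {..<T} \<times> {..<b}" using pt_in_vertices[OF assms(2)] by auto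
qed

text \<open>A vertex and a direction \<open>u\<close> determine the line, so each vertex lies on at
  most \<open>q\<close> lines.\<close>

lemma sum_card_line_trace:
  assumes F: "F \<subseteq> vertices T q b"
  shows "(\<Sum>a\<in>lines T q. card (line_trace F a)) \<le> q * card F"
proof -
  have fin: "finite F" by (rule finite_subset[OF F]) simp
  have ft: "finite (line_trace F a)" if "a \<in> lines T q" for a
    by (rule finite_subset[OF line_trace_subset[OF F that]]) simp
  let ?S = "SIGMA a:lines T q. line_trace F a"
  let ?f = "\<lambda>(a, t, i). (pt a t i, snd (snd a))"
  have "inj_on ?f ?S"
  proof (rule inj_onI)
    fix p p' assume eq: "?f p = ?f p'"
    obtain x y u t i where p: "p = ((x, y, u), t, i)" by (metis prod_cases3)
    obtain x' y' u' t' i' where p': "p' = ((x', y', u'), t', i')" by (metis prod_cases3)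
    have "t = t'" "i = i'" "u = u'" "x + t * u = x' + t' * u'" "y + t * u\<^sup>2 = y' + t' * u'\<^sup>2"
      using eq unfolding p p' pt_def by auto
    then show "p = p'" unfolding p p' by simp
  qed
  moreover have "?f ` ?S \<subseteq> F \<times> {..<q}"
    by (auto simp: line_trace_def lines_def)
  ultimately have "card ?S \<le> card (F \<times> {..<q})"
    using fin by (intro card_inj_on_le) auto
  then show ?thesis using ft by (simp add: card_SigmaI card_cartesian_product mult.commute)
qed

text \<open>By double counting, the average trace has at most \<open>T * b / 8\<close> positions; by
  Markov's inequality at most half of the lines exceed twice that.\<close>

lemma many_sparse_lines:
  assumes F: "F \<subseteq> vertices T q b" and card: "32 * card F \<le> card (vertices T q b)"
    and pos: "T > 0" "b > 0"
  shows "card (lines T q) \<le> 2 * card {a \<in> lines T q. 4 * card (line_trace F a) \<le> T * b}"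
proof -
  let ?bad = "{a \<in> lines T q. \<not> 4 * card (line_trace F a) \<le> T * b}"
  let ?good = "{a \<in> lines T q. 4 * card (line_trace F a) \<le> T * b}"
  have "lines T q = ?good \<union> ?bad" by auto
  then have split: "card (lines T q) = card ?good + card ?bad"
    by (metis (no_types, lifting) card_Un_disjoint disjoint_iff finite_Un finite_lines mem_Collect_eq)
  have "card ?bad * (T * b) = (\<Sum>a\<in>?bad. T * b)" by simp
  also have "\<dots> \<le> (\<Sum>a\<in>?bad. 4 * card (line_trace F a))" by (intro sum_mono) auto
  also have "\<dots> \<le> (\<Sum>a\<in>lines T q. 4 * card (line_trace F a))" by (intro sum_mono2) auto
  also have "\<dots> \<le> 4 * (q * card F)"
    using sum_card_line_trace[OF F] by (simp add: sum_distrib_left[symmetric])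
  finally have "8 * (card ?bad * (T * b)) \<le> 8 * (4 * (q * card F))" by (rule mult_le_mono2)
  also have "\<dots> = q * (32 * card F)" by simp
  also have "\<dots> \<le> q * (4 * T ^ 3 * q ^ 3 * b)"
    using card unfolding card_vertices by (rule mult_le_mono2)
  also have "\<dots> = 4 * card (lines T q) * (T * b)"
    unfolding card_lines by (simp add: algebra_simps power3_eq_cube power2_eq_square power4_eq_xxxx)
  finally have "(2 * card ?bad) * (T * b) \<le> card (lines T q) * (T * b)" by simp
  then have "2 * card ?bad \<le> card (lines T q)" using pos by simp
  then show ?thesis using split by simp
qed

text \<open>At most \<open>2 * N\<close> of the \<open>4 * N\<close> layers can have more than half
  of their \<open>8 * N\<close> positions in \<open>G\<close>. Each remaining layer has at least
  \<open>4 * N\<close> free positions and misses a given label with probability at most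
  \<open>exp (- 4)\<close>.\<close>

lemma card_chainless_sparse:
  assumes N: "N > 0" and G: "G \<subseteq> {..<4 * N} \<times> {..<8 * N}" and card: "card G \<le> 8 * N\<^sup>2"
  shows "real (card (chainless N (8 * N) G N (4 * N))) \<le> real (N ^ (8 * N * (4 * N))) / 4 ^ N"
proof -
  let ?row = "\<lambda>t. {i. i < 8 * N \<and> (t, i) \<in> G}"
  define S where "S = {t. t < 4 * N \<and> card (?row t) \<le> 4 * N}"
  let ?bad = "{t. t < 4 * N \<and> \<not> card (?row t) \<le> 4 * N}"
  have "G = (SIGMA t:{..<4 * N}. ?row t)" using G by auto
  then have cG: "card G = (\<Sum>t<4 * N. card (?row t))"
    using card_SigmaI[of "{..<4 * N}" ?row] by simp
  have "card ?bad * (4 * N) = (\<Sum>t\<in>?bad. 4 * N)" by simp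
  also have "\<dots> \<le> (\<Sum>t\<in>?bad. card (?row t))" by (intro sum_mono) auto
  also have "\<dots> \<le> card G" unfolding cG by (intro sum_mono2) auto
  also have "\<dots> \<le> (2 * N) * (4 * N)" using card by (simp add: power2_eq_square)
  finally have bad: "card ?bad \<le> 2 * N" using N by simp
  have "{..<4 * N} = S \<union> ?bad" unfolding S_def by auto
  then have "4 * N = card (S \<union> ?bad)" by (metis card_lessThan)
  also have "\<dots> \<le> card S + card ?bad" by (rule card_Un_le)
  finally have "4 * N \<le> card S + card ?bad" .
  moreover have "{t \<in> S. t < 4 * N} = S" unfolding S_def by auto
  ultimately have cS: "2 * N \<le> card {t \<in> S. t < 4 * N}" using bad by simp
  have e4: "exp (- 4 :: real) \<le> 1 / 16"
  proof -
    have "(2::real) ^ 4 \<le> exp 1 ^ 4" using exp_ge_add_one_self[of 1] by (intro power_mono) auto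
    also have "\<dots> = exp 4" by (simp add: exp_of_nat_mult[symmetric])
    finally show ?thesis by (simp add: exp_minus field_simps)
  qed
  have row: "(1 - 1 / real N) ^ card {i. i < 8 * N \<and> (t, i) \<notin> G} \<le> 1 / 16" if "t \<in> S" for t
  proof -
    have "{..<8 * N} = ?row t \<union> {i. i < 8 * N \<and> (t, i) \<notin> G}" by auto
    then have "8 * N \<le> card (?row t) + card {i. i < 8 * N \<and> (t, i) \<notin> G}"
      by (metis (no_types, lifting) card_Un_le card_lessThan)
    then have le: "4 * N \<le> card {i. i < 8 * N \<and> (t, i) \<notin> G}" using that unfolding S_def by simp
    have "(1 - 1 / real N) ^ card {i. i < 8 * N \<and> (t, i) \<notin> G} \<le> (1 - 1 / real N) ^ (4 * N)"
      using N le by (intro power_decreasing) auto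
    also have "\<dots> \<le> exp (- 1 / real N) ^ (4 * N)"
      using N exp_ge_add_one_self[of "- 1 / real N"] by (intro power_mono) auto
    also have "\<dots> = exp (- 4)" using N by (simp add: exp_of_nat_mult[symmetric])
    finally show ?thesis using e4 by simp
  qed
  \<comment> \<open>With \<open>\<rho> = 1 / 16\<close>, the gain \<open>(1 / 8) ^ (2 * N)\<close>
    beats the loss \<open>16 ^ N\<close> by the factor \<open>4 ^ N\<close>.\<close>
  have "real (card (chainless N (8 * N) G N (4 * N)))
      \<le> real (N ^ (8 * N * (4 * N))) * (2 * (1 / 16)) ^ card {t \<in> S. t < 4 * N} / (1 / 16) ^ N"
    by (rule card_chainless) (use row in auto)
  also have "\<dots> \<le> real (N ^ (8 * N * (4 * N))) * (1 / 8) ^ (2 * N) / (1 / 16) ^ N"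
    using power_decreasing[OF cS, of "1 / 8 :: real"]
    by (intro divide_right_mono mult_left_mono) auto
  also have "\<dots> = real (N ^ (8 * N * (4 * N))) * (1 / 4) ^ N"
  proof -
    have "(1 / 8 :: real) ^ (2 * N) = (1 / 64) ^ N" by (simp add: power_mult power2_eq_square)
    also have "\<dots> = (1 / 4) ^ N * (1 / 16) ^ N" by (simp add: power_mult_distrib[symmetric])
    finally show ?thesis by simp
  qed
  finally show ?thesis by (simp add: power_one_over)
qed

text \<open>A union bound over the at most \<open>2 ^ card V\<close> small sets \<open>F\<close>,
  where \<open>V\<close> is the vertex set: the lines are labeled independently, so the failure
  probabilities of the sparse lines multiply.\<close>

lemma exists_robust_labeling:
  assumes N: "N > 0" and T: "T = 4 * N" and b: "b = 8 * N" and q: "q = 256 * N"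
  obtains \<Lambda> where "\<And>a t i. a \<in> lines T q \<Longrightarrow> t < T \<Longrightarrow> i < b \<Longrightarrow> \<Lambda> a t i < N"
    and "\<And>F. F \<subseteq> vertices T q b \<Longrightarrow> 32 * card F \<le> card (vertices T q b) \<Longrightarrow>
      \<exists>a\<in>lines T q. chain (\<Lambda> a) (line_trace F a) b N T"
proof -
  let ?A = "lines T q" and ?V = "vertices T q b" and ?L = "labelings N b T"
  let ?K = "real (N ^ (b * T))"
  define All where "All = PiE ?A (\<lambda>_. ?L)"
  define Sparse where "Sparse F = {a \<in> ?A. 4 * card (line_trace F a) \<le> T * b}" for F
  \<comment> \<open>\<open>Kill F\<close> collects the families for which no sparse line has a full
    chain avoiding \<open>F\<close>; the other lines are unconstrained.\<close>
  define Kill where "Kill F = PiE ?A (\<lambda>a. if a \<in> Sparse F then chainless N b (line_trace F a) N T else ?L)" for F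
  define Small where "Small = {F. F \<subseteq> ?V \<and> 32 * card F \<le> card ?V}"
  have finA: "finite All" unfolding All_def by (intro finite_PiE) auto
  have cAll: "real (card All) = ?K ^ card ?A"
    unfolding All_def by (simp add: card_PiE card_labelings)
  have cKill: "real (card (Kill F)) \<le> ?K ^ card ?A / 2 ^ (N * card ?A)" if F: "F \<in> Small" for F
  proof -
    have sp: "real (card (chainless N b (line_trace F a) N T)) \<le> ?K * (1 / 4 ^ N)" if "a \<in> Sparse F" for a
      using card_chainless_sparse[OF N, of "line_trace F a"] line_trace_subset[of F T q b a] that F
      unfolding T b Sparse_def Small_def by (auto simp: power2_eq_square)
    have "real (card (Kill F)) = (\<Prod>a\<in>?A. real (card (if a \<in> Sparse F then chainless N b (line_trace F a) N T else ?L)))"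
      unfolding Kill_def by (simp add: card_PiE)
    also have "\<dots> \<le> (\<Prod>a\<in>?A. ?K * (if a \<in> Sparse F then 1 / 4 ^ N else 1))"
      using sp by (intro prod_mono) (auto simp: card_labelings)
    also have "\<dots> = ?K ^ card ?A * (\<Prod>a\<in>?A. if a \<in> Sparse F then 1 / 4 ^ N else 1)"
      by (simp add: prod.distrib)
    also have "(\<Prod>a\<in>?A. if a \<in> Sparse F then 1 / 4 ^ N else (1::real)) = (1 / 4 ^ N) ^ card (Sparse F)"
    proof -
      have "?A \<inter> {a. a \<in> Sparse F} = Sparse F" unfolding Sparse_def by auto
      then show ?thesis by (subst prod.If_cases) auto
    qed
    also have "(1 / 4 ^ N) ^ card (Sparse F) = 1 / (2::real) ^ (N * (2 * card (Sparse F)))"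
    proof -
      have "(2::real) ^ (N * (2 * card (Sparse F))) = (2 ^ 2) ^ (N * card (Sparse F))"
        unfolding power_mult[symmetric] by (simp add: mult_ac)
      then show ?thesis by (simp add: power_one_over power_mult)
    qed
    also have "\<dots> \<le> 1 / 2 ^ (N * card ?A)"
      \<comment> \<open>At least half of the lines are sparse, which turns \<open>4\<close> per
        sparse line into \<open>2\<close> per line.\<close>
      using many_sparse_lines[of F T q b] F N unfolding Small_def Sparse_def T b
      by (intro divide_left_mono power_increasing mult_le_mono) auto
    finally show ?thesis by (simp add: mult_left_mono)
  qed
  have finS: "finite Small" and cS: "card Small \<le> 2 ^ card ?V"
  proof -
    have sub: "Small \<subseteq> Pow ?V" unfolding Small_def by auto
    show "finite Small" by (rule finite_subset[OF sub]) simp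
    show "card Small \<le> 2 ^ card ?V" using card_mono[OF _ sub] by (simp add: card_Pow)
  qed
  \<comment> \<open>The ratio of the two sides is \<open>N * q / (4 * T * b)\<close>; the choice
    \<open>q = 256 * N\<close> makes it \<open>2\<close>.\<close>
  have ex: "card ?V < N * card ?A"
  proof -
    have "card ?V = 2 ^ 35 * N ^ 7" "N * card ?A = 2 ^ 36 * N ^ 7"
      unfolding card_vertices card_lines T b q by (simp_all add: power_mult_distrib power_numeral_reduce mult_ac)
    then show ?thesis using N by simp
  qed
  have Kpos: "0 < ?K ^ card ?A" using N by simp
  have finK: "finite (Kill F)" for F unfolding Kill_def by (intro finite_PiE) auto
  have "real (card (\<Union>F\<in>Small. Kill F)) \<le> (\<Sum>F\<in>Small. real (card (Kill F)))"
    using card_UN_le[OF finS, of Kill] by (metis of_nat_mono of_nat_sum)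
  also have "\<dots> \<le> (\<Sum>F\<in>Small. ?K ^ card ?A / 2 ^ (N * card ?A))" by (intro sum_mono cKill)
  also have "\<dots> \<le> 2 ^ card ?V * (?K ^ card ?A / 2 ^ (N * card ?A))"
  proof -
    have "real (card Small) \<le> 2 ^ card ?V" using cS by (metis of_nat_le_iff of_nat_numeral of_nat_power)
    then show ?thesis unfolding sum_constant by (rule mult_right_mono) simp
  qed
  also have "\<dots> < ?K ^ card ?A"
  proof -
    have "(2::real) ^ card ?V < 2 ^ (N * card ?A)" using ex by simp
    then show ?thesis using Kpos by (simp add: field_simps)
  qed
  finally have "card (\<Union>F\<in>Small. Kill F) < card All" unfolding cAll[symmetric] by simp
  then have "\<not> All \<subseteq> (\<Union>F\<in>Small. Kill F)"
    using card_mono[of "\<Union>F\<in>Small. Kill F" All] finS finK by (meson finite_UN not_le)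
  then obtain \<Lambda> where \<Lambda>: "\<Lambda> \<in> All" "\<And>F. F \<in> Small \<Longrightarrow> \<Lambda> \<notin> Kill F" by blast
  show thesis
  proof
    fix a t i assume "a \<in> ?A" "t < T" "i < b"
    then show "\<Lambda> a t i < N" using \<Lambda>(1) unfolding All_def labelings_def by (auto simp: PiE_iff)
  next
    fix F assume "F \<subseteq> ?V" "32 * card F \<le> card ?V"
    then have "\<Lambda> \<notin> Kill F" using \<Lambda>(2) unfolding Small_def by auto
    then obtain a where a: "a \<in> ?A" "\<Lambda> a \<notin> (if a \<in> Sparse F then chainless N b (line_trace F a) N T else ?L)"
      using \<Lambda>(1) unfolding Kill_def All_def PiE_iff by blast
    have "\<Lambda> a \<in> ?L" using \<Lambda>(1) a(1) unfolding All_def by auto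
    then have "chain (\<Lambda> a) (line_trace F a) b N T"
      using a unfolding chainless_def by (auto split: if_splits)
    then show "\<exists>a\<in>?A. chain (\<Lambda> a) (line_trace F a) b N T" using a by blast
  qed
qed

subsection \<open>The quasimetric\<close>

text \<open>Weak linear programming duality: the expected weight of the cut pairs is at least
  \<open>L\<close>, while the Lipschitz condition bounds the cut probability of each pair.\<close>

lemma lipschitz_duality:
  fixes D :: "('a \<times> 'a) set pmf" and w dr :: "'a \<times> 'a \<Rightarrow> real"
  assumes D: "quasipartition_distribution M d r D" "lipschitz_distribution M d r \<beta> D"
    and E: "finite E" "E \<subseteq> M \<times> M" and w: "\<And>e. e \<in> E \<Longrightarrow> w e \<ge> 0"
    and d: "\<And>e. e \<in> E \<Longrightarrow> d (fst e) (snd e) = ennreal (dr e) \<and> dr e \<ge> 0"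
    and r: "r > 0" and \<beta>: "\<beta> \<ge> 0"
    and cut: "\<And>P. quasipartition M P \<Longrightarrow> bounded_relation d r P \<Longrightarrow> (\<Sum>e\<in>E. if e \<in> P then 0 else w e) \<ge> L"
  shows "L * r \<le> \<beta> * (\<Sum>e\<in>E. w e * dr e)"
proof -
  let ?Z = "\<lambda>P. \<Sum>e\<in>E. w e * indicator {P. e \<notin> P} P :: real"
  have int: "integrable D (\<lambda>P. w e * indicator {P. e \<notin> P} P :: real)" for e
    by (intro integrable_mult_right measure_pmf.integrable_const_bound[where B = 1]) auto
  have "L = measure_pmf.expectation D (\<lambda>_. L)" by simp
  also have "\<dots> \<le> measure_pmf.expectation D ?Z"
  proof (intro integral_mono_AE)
    show "AE P in D. L \<le> ?Z P"
    proof (rule AE_pmfI)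
      fix P assume "P \<in> set_pmf D"
      then have "L \<le> (\<Sum>e\<in>E. if e \<in> P then 0 else w e)"
        using D(1) cut unfolding quasipartition_distribution_def by blast
      also have "\<dots> = ?Z P" by (intro sum.cong) (auto simp: indicator_def)
      finally show "L \<le> ?Z P" .
    qed
  qed (use int in auto)
  also have "\<dots> = (\<Sum>e\<in>E. w e * measure_pmf.prob D {P. e \<notin> P})"
    using int by (subst Bochner_Integration.integral_sum) auto
  also have "\<dots> \<le> (\<Sum>e\<in>E. w e * (\<beta> * dr e / r))"
  proof (intro sum_mono mult_left_mono w)
    fix e assume e: "e \<in> E"
    obtain x y where xy: "e = (x, y)" by (cases e)
    then have "x \<in> M" "y \<in> M" "d x y = ennreal (dr e)" using e E(2) d[OF e] by auto
    then have "ennreal (measure_pmf.prob D {P. e \<notin> P}) \<le> ennreal \<beta> * ennreal (dr e) / ennreal r"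
      using D(2) unfolding lipschitz_distribution_def xy by metis
    also have "\<dots> = ennreal (\<beta> * dr e / r)"
      using \<beta> r d[OF e] by (simp add: ennreal_mult[symmetric] divide_ennreal)
    finally show "measure_pmf.prob D {P. e \<notin> P} \<le> \<beta> * dr e / r"
      using \<beta> r d[OF e] by (subst (asm) ennreal_le_iff) auto
  qed
  also have "\<dots> = \<beta> * (\<Sum>e\<in>E. w e * dr e) / r"
    by (simp add: sum_distrib_left sum_divide_distrib mult_ac)
  finally show ?thesis using r by (simp add: field_simps)
qed

text \<open>Each single difference telescopes through \<open>z\<close>. Inserting \<open>0\<close>
  makes the maxima nonnegative, and defined for empty \<open>I\<close>.\<close>

lemma finite_potentials_triangle:
  fixes f :: "'i \<Rightarrow> 'p \<Rightarrow> real"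
  assumes "finite I"
  shows "Max (insert 0 ((\<lambda>a. f a q - f a p) ` I))
    \<le> Max (insert 0 ((\<lambda>a. f a z - f a p) ` I)) + Max (insert 0 ((\<lambda>a. f a q - f a z) ` I))"
    (is "?pq \<le> ?pz + ?zq")
proof (rule Max.boundedI)
  fix c assume "c \<in> insert 0 ((\<lambda>a. f a q - f a p) ` I)"
  moreover have "0 \<le> ?pz" "0 \<le> ?zq" using assms by (auto intro: Max_ge)
  moreover have "f a q - f a p \<le> ?pz + ?zq" if "a \<in> I" for a
  proof -
    have "f a z - f a p \<le> ?pz" "f a q - f a z \<le> ?zq" using assms that by (auto intro: Max_ge)
    then show ?thesis by simp
  qed
  ultimately show "c \<le> ?pz + ?zq" by auto
qed (use assms in auto)

text \<open>These properties are all that the metric argument uses; the sizes of \<open>T\<close>,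
  \<open>b\<close> and \<open>q\<close> enter only through \<open>exists_robust_labeling\<close> and
  the final count.\<close>

locale robust_labeling =
  fixes N T b q :: nat and \<Lambda> :: "line \<Rightarrow> nat \<Rightarrow> nat \<Rightarrow> nat"
  assumes label_less: "\<lbrakk>a \<in> lines T q; t < T; i < b\<rbrakk> \<Longrightarrow> \<Lambda> a t i < N"
    and robust: "\<lbrakk>F \<subseteq> vertices T q b; 32 * card F \<le> card (vertices T q b)\<rbrakk> \<Longrightarrow>
      \<exists>a\<in>lines T q. chain (\<Lambda> a) (line_trace F a) b N T"
    and pos: "N > 0" "T > 0" "b > 0" "q > 0"
begin

text \<open>The distance is defined directly as a maximum of potential differences instead of by shortest
  paths. Each vertex is split into an entrance \<open>(v, False)\<close> and an exit \<open>(v, True)\<close> about \<open>1\<close> apart;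
  the crossings have the tiny length \<open>\<eta>\<close>, so that cutting any of them is too expensive.\<close>

fun gap :: "line \<Rightarrow> vertex \<Rightarrow> int" where
  "gap (x0, y0, u) (t, x, y, i) = int y - int y0 - 2 * int u * (int x - int x0) + (int u)\<^sup>2 * int t"

text \<open>Per layer the gap changes by \<open>u'\<^sup>2 - 2 * u * u' + u\<^sup>2\<close>, the
  distance of the parabola at \<open>u'\<close> from its tangent at \<open>u\<close>.\<close>

lemma gap_pt_diff:
  "gap (x0, y0, u) (pt (x, y, u') t' i') - gap (x0, y0, u) (pt (x, y, u') t i)
    = (int t' - int t) * (int u' - int u)\<^sup>2"
  by (simp add: pt_def algebra_simps power2_eq_square)

lemma gap_pt_self [simp]: "gap a (pt a t i) = 0"
  by (cases a) (simp add: pt_def algebra_simps power2_eq_square)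

text \<open>Designed to rise by at most \<open>1\<close> inside a vertex and never along a crossing,
  yet by \<open>N\<close> along its own line. Vertices off the line with gap \<open>0\<close> are
  treated like those with negative gap and get the largest value, so moving on from them cannot
  increase the potential.\<close>

definition pot :: "line \<Rightarrow> vertex \<times> bool \<Rightarrow> real" where
  "pot a = (\<lambda>((t, x, y, i), s).
     if gap a (t, x, y, i) < 0 then real N
     else if gap a (t, x, y, i) > 0 then 0
     else if (t, x, y, i) = pt a t i then real (\<Lambda> a t i) + of_bool s
     else real N)"

lemma pot_pt: "pot a (pt a t i, s) = real (\<Lambda> a t i) + of_bool s"
proof -
  obtain v1 v2 v3 v4 where v: "pt a t i = (v1, v2, v3, v4)" by (metis prod_cases4)
  moreover from this have "v1 = t" "v4 = i" by (cases a, simp add: pt_def)+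
  ultimately show ?thesis using gap_pt_self[of a t i] by (simp add: pot_def)
qed

lemma pot_above: "gap a v > 0 \<Longrightarrow> pot a (v, s) = 0"
  by (cases v) (simp add: pot_def)

lemma pot_off: "gap a v \<le> 0 \<Longrightarrow> \<forall>t i. v \<noteq> pt a t i \<Longrightarrow> pot a (v, s) = real N"
  by (cases v) (auto simp add: pot_def)

lemma pot_out_le: "pot a (v, True) \<le> pot a (v, False) + 1"
  by (cases v) (simp add: pot_def)

section \<open>Crossings and the monotonicity of potentials\<close>

definition crossing :: "(vertex \<times> vertex) set" where
  "crossing = {(pt a t i, pt a t' i') | a t i t' i'.
     a \<in> lines T q \<and> t < t' \<and> t' < T \<and> i < b \<and> i' < b \<and> \<Lambda> a t' i' = Suc (\<Lambda> a t i)}"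

lemma crossing_subset: "crossing \<subseteq> vertices T q b \<times> vertices T q b"
  unfolding crossing_def using pt_in_vertices by fastforce

lemma finite_crossing [simp]: "finite crossing"
  by (rule finite_subset[OF crossing_subset]) simp

lemma pot_le:
  assumes "a \<in> lines T q" "v \<in> vertices T q b"
  shows "pot a (v, False) \<le> real N"
proof (cases "\<exists>t i. v = pt a t i")
  case True
  then obtain t i where "v = pt a t i" by blast
  moreover from this have "\<Lambda> a t i < N"
    using assms pt_in_vertices[of a T q t i b] label_less by auto
  ultimately show ?thesis by (simp add: pot_pt)
next
  case False
  then show ?thesis using pot_above[of a v False] pot_off[of a v False]
    by (cases "gap a v > 0") auto
qed

text \<open>The gap never decreases along a crossing, and by strict convexity of \<open>u \<mapsto> u\<^sup>2\<close> it stays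
  the same only in the direction of the line. So no walk can leave the line and return to it.\<close>

lemma pot_crossing:
  assumes "(v, w) \<in> crossing" "a \<in> lines T q"
  shows "pot a (w, False) \<le> pot a (v, True)"
proof -
  obtain c t i t' i' where c: "c \<in> lines T q" "v = pt c t i" "w = pt c t' i'" "t < t'" "t' < T"
      "i < b" "i' < b" "\<Lambda> c t' i' = Suc (\<Lambda> c t i)"
    using assms(1) unfolding crossing_def by auto
  obtain x0 y0 u where a: "a = (x0, y0, u)" by (cases a)
  obtain x y u' where cc: "c = (x, y, u')" by (cases c)
  have diff: "gap a w - gap a v = (int t' - int t) * (int u' - int u)\<^sup>2"
    unfolding a c cc by (rule gap_pt_diff)
  have w: "w \<in> vertices T q b" using crossing_subset assms(1) by auto
  show ?thesis
  proof (cases "gap a w > 0")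
    case True
    moreover have "0 \<le> pot a (v, True)" by (cases v) (auto simp: pot_def)
    ultimately show ?thesis by (simp add: pot_above)
  next
    case w_le: False
    show ?thesis
    proof (cases "\<exists>t i. v = pt a t i")
      case False
      moreover have "gap a v \<le> 0" using diff w_le c(4) by (smt (verit) mult_nonneg_nonneg of_nat_less_iff zero_le_power2)
      ultimately show ?thesis using pot_off[of a v True] pot_le[OF assms(2) w] by simp
    next
      case True
      \<comment> \<open>Layer and copy are coordinates of a vertex, so the witnesses agree with the
        \<open>t\<close> and \<open>i\<close> of the line \<open>c\<close>.\<close>
      then have v: "v = pt a t i" unfolding c by (auto simp: pt_def a cc)
      then have "(int t' - int t) * (int u' - int u)\<^sup>2 \<le> 0" using diff w_le by simp
      then have "(int u' - int u)\<^sup>2 \<le> 0" using c(4) by (simp add: mult_le_0_iff)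
      then have "u' = u" by simp
      then have "c = a" using v unfolding c by (auto simp: pt_def a cc)
      then show ?thesis using c by (simp add: pot_pt)
    qed
  qed
qed

text \<open>Chosen so that one \<open>\<eta>\<close> per crossing and one more, for the vertex
  itself, add up to exactly \<open>1\<close> in \<open>lipschitz_bound\<close>.\<close>

definition \<eta> :: real where
  "\<eta> = 1 / (real (card crossing) + 1)"

text \<open>The maximum alone can vanish at distinct points; the summand \<open>\<eta>\<close>
  separates them.\<close>

definition dist_real :: "vertex \<times> bool \<Rightarrow> vertex \<times> bool \<Rightarrow> real" where
  "dist_real p p' = (if p = p' then 0 else \<eta>) + Max (insert 0 ((\<lambda>a. pot a p' - pot a p) ` lines T q))"

abbreviation "points \<equiv> vertices T q b \<times> (UNIV :: bool set)"

abbreviation "qdist p p' \<equiv> ennreal (dist_real p p')"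

lemma \<eta>_pos: "\<eta> > 0"
  unfolding \<eta>_def by (simp add: add_pos_nonneg)

lemma excess_nonneg: "0 \<le> Max (insert 0 ((\<lambda>a. pot a p' - pot a p) ` lines T q))"
  by (intro Max_ge) auto

lemma dist_real_nonneg: "0 \<le> dist_real p p'"
  unfolding dist_real_def using \<eta>_pos excess_nonneg[of p' p] by simp

lemma quasimetric_points: "quasimetric_space points qdist"
proof
  fix p p'
  show "qdist p p' = 0 \<longleftrightarrow> p = p'"
  proof
    assume "qdist p p' = 0"
    then have "dist_real p p' \<le> 0" by (simp add: ennreal_eq_0_iff)
    then have "\<not> 0 < dist_real p p'" by simp
    moreover have "0 < dist_real p p'" if "p \<noteq> p'"
      unfolding dist_real_def if_not_P[OF that] by (rule add_pos_nonneg[OF \<eta>_pos excess_nonneg])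
    ultimately show "p = p'" by blast
  next
    assume "p = p'"
    have eq: "insert 0 ((\<lambda>a. pot a p - pot a p) ` lines T q) = {0}" by auto
    have "dist_real p p = 0" unfolding dist_real_def eq by simp
    then show "qdist p p' = 0" using \<open>p = p'\<close> by simp
  qed
next
  fix p p' z
  \<comment> \<open>The \<open>\<eta>\<close> summand is subadditive: if
    \<open>p \<noteq> p'\<close>, then \<open>p \<noteq> z\<close> or
    \<open>z \<noteq> p'\<close>.\<close>
  have "dist_real p p' \<le> dist_real p z + dist_real z p'"
    using finite_potentials_triangle[OF finite_lines, of pot p' p T q z] \<eta>_pos
    unfolding dist_real_def by (smt (verit, ccfv_threshold))
  then show "qdist p p' \<le> qdist p z + qdist z p'"
    by (simp add: ennreal_plus[symmetric] dist_real_nonneg ennreal_leI del: ennreal_plus)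
qed

section \<open>Lengths of vertex pairs, crossings and full lines\<close>

lemma dist_vertex: "dist_real (v, False) (v, True) \<le> 1 + \<eta>"
proof -
  have "Max (insert 0 ((\<lambda>a. pot a (v, True) - pot a (v, False)) ` lines T q)) \<le> 1"
    using pot_out_le[of _ v] by (intro Max.boundedI) (auto simp del: split_paired_All simp: le_diff_eq diff_le_eq add.commute)
  then show ?thesis unfolding dist_real_def by simp
qed

lemma dist_crossing:
  assumes "(v, w) \<in> crossing"
  shows "dist_real (v, True) (w, False) \<le> \<eta>"
proof -
  have "Max (insert 0 ((\<lambda>a. pot a (w, False) - pot a (v, True)) ` lines T q)) \<le> 0"
    using pot_crossing[OF assms] by (intro Max.boundedI) auto
  then show ?thesis unfolding dist_real_def by simp
qed

text \<open>The potential of \<open>a\<close> itself rises from \<open>0\<close> at the entrance to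
  \<open>N\<close> at the exit; \<open>\<eta>\<close> makes the inequality strict, so an
  \<open>N\<close>-bounded relation excludes the pair.\<close>

lemma dist_line:
  assumes "a \<in> lines T q" "\<Lambda> a t i = 0" "Suc (\<Lambda> a t' i') = N"
  shows "dist_real (pt a t i, False) (pt a t' i', True) > real N"
proof -
  have "pot a (pt a t' i', True) - pot a (pt a t i, False) = real N"
    unfolding pot_pt using assms(2,3) by simp
  then have "real N \<le> Max (insert 0 ((\<lambda>c. pot c (pt a t' i', True) - pot c (pt a t i, False)) ` lines T q))"
    using assms(1) by (intro Max_ge) (auto simp: rev_image_eqI)
  then show ?thesis unfolding dist_real_def using \<eta>_pos by simp
qed

text \<open>Outside \<open>F\<close> the chain alternates between vertex pairs and crossings, all in
  \<open>P\<close>, and transitivity composes them. A chain of length \<open>Suc k\<close> ends at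
  label \<open>k\<close>.\<close>

lemma chain_connects:
  assumes a: "a \<in> lines T q" and P: "trans P"
    and cross: "\<And>v w. (v, w) \<in> crossing \<Longrightarrow> ((v, True), (w, False)) \<in> P"
    and F: "\<And>v. v \<in> vertices T q b \<Longrightarrow> v \<notin> F \<Longrightarrow> ((v, False), (v, True)) \<in> P"
  shows "chain (\<Lambda> a) (line_trace F a) b (Suc k) L \<Longrightarrow> L \<le> T \<Longrightarrow>
    \<exists>t<L. \<exists>i<b. \<Lambda> a t i = k \<and> (\<exists>t0 i0. \<Lambda> a t0 i0 = 0 \<and> ((pt a t0 i0, False), (pt a t i, True)) \<in> P)"
proof (induction k arbitrary: L)
  case 0
  then obtain t i where ti: "t < L" "i < b" "(t, i) \<notin> line_trace F a" "\<Lambda> a t i = 0" by auto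
  then have "((pt a t i, False), (pt a t i, True)) \<in> P"
    using F[of "pt a t i"] pt_in_vertices[OF a] 0 by (auto simp: line_trace_def)
  then show ?case using ti by blast
next
  case (Suc k)
  obtain t i where ti: "t < L" "i < b" "(t, i) \<notin> line_trace F a" "\<Lambda> a t i = Suc k"
      "chain (\<Lambda> a) (line_trace F a) b (Suc k) t"
    using Suc.prems(1) by (subst (asm) chain.simps) blast
  obtain t' i' t0 i0 where s: "t' < t" "i' < b" "\<Lambda> a t' i' = k" "\<Lambda> a t0 i0 = 0"
      "((pt a t0 i0, False), (pt a t' i', True)) \<in> P"
    using Suc.IH[OF ti(5)] ti(1) Suc.prems(2) by auto
  have "(pt a t' i', pt a t i) \<in> crossing"
    unfolding crossing_def using a ti s Suc.prems(2) by fastforce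
  then have "((pt a t' i', True), (pt a t i, False)) \<in> P" by (rule cross)
  moreover have "((pt a t i, False), (pt a t i, True)) \<in> P"
    using F[of "pt a t i"] pt_in_vertices[OF a] ti Suc.prems(2) by (auto simp: line_trace_def)
  ultimately have "((pt a t0 i0, False), (pt a t i, True)) \<in> P"
    using s(5) P by (meson transD)
  then show ?case using ti s by blast
qed

text \<open>If fewer vertices were cut, robustness would give a full chain avoiding them, and
  \<open>P\<close> would contain a pair at distance greater than \<open>N\<close>.\<close>

lemma bounded_quasipartition_cuts:
  assumes P: "quasipartition points P" "bounded_relation qdist (real N) P"
    and cross: "\<And>v w. (v, w) \<in> crossing \<Longrightarrow> ((v, True), (w, False)) \<in> P"
  shows "card (vertices T q b) \<le> 32 * card {v \<in> vertices T q b. ((v, False), (v, True)) \<notin> P}"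
proof (rule ccontr)
  let ?F = "{v \<in> vertices T q b. ((v, False), (v, True)) \<notin> P}"
  assume "\<not> ?thesis"
  then obtain a where a: "a \<in> lines T q" "chain (\<Lambda> a) (line_trace ?F a) b N T"
    using robust[of ?F] by auto
  obtain k where k: "N = Suc k" using pos(1) by (cases N) auto
  have "\<exists>t<T. \<exists>i<b. \<Lambda> a t i = k \<and> (\<exists>t0 i0. \<Lambda> a t0 i0 = 0 \<and> ((pt a t0 i0, False), (pt a t i, True)) \<in> P)"
    by (rule chain_connects[OF a(1) _ cross, where F = ?F])
      (use P(1) a(2) k in \<open>auto simp: quasipartition_def\<close>)
  then obtain t i t0 i0 where *: "\<Lambda> a t i = k" "\<Lambda> a t0 i0 = 0" "((pt a t0 i0, False), (pt a t i, True)) \<in> P"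
    by blast
  then have "qdist (pt a t0 i0, False) (pt a t i, True) \<le> ennreal (real N)"
    using P(2) unfolding bounded_relation_def by blast
  then have "dist_real (pt a t0 i0, False) (pt a t i, True) \<le> real N"
    by (subst (asm) ennreal_le_iff) auto
  then show False using dist_line[OF a(1) *(2), of t i] *(1) k by simp
qed

lemma lipschitz_bound:
  assumes D: "quasipartition_distribution points qdist (real N) D"
      "lipschitz_distribution points qdist (real N) \<beta> D" and \<beta>: "\<beta> \<ge> 0"
  shows "real N / 64 \<le> \<beta>"
proof -
  let ?V = "vertices T q b"
  let ?E1 = "(\<lambda>v. ((v, False), (v, True))) ` ?V"
  let ?E2 = "(\<lambda>e. ((fst e, True), (snd e, False))) ` crossing"
  \<comment> \<open>A pair starting at an exit is a crossing. Its weight equals that of all vertex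
    pairs together.\<close>
  let ?w = "\<lambda>e. if snd (fst e) then real (card ?V) else 1"
  let ?d = "\<lambda>e. dist_real (fst e) (snd e)"
  have disj: "?E1 \<inter> ?E2 = {}" by auto
  have Vpos: "0 < card ?V" unfolding card_vertices using pos by simp
  have inj1: "inj_on (\<lambda>v. ((v, False), (v, True))) ?V"
    and inj2: "inj_on (\<lambda>e. ((fst e, True), (snd e, False))) crossing"
    by (auto simp: inj_on_def prod_eq_iff)
  have sum: "(\<Sum>e\<in>?E1 \<union> ?E2. g e)
      = (\<Sum>v\<in>?V. g ((v, False), (v, True))) + (\<Sum>e\<in>crossing. g ((fst e, True), (snd e, False)))"
    for g :: "_ \<Rightarrow> real"
    by (subst sum.union_disjoint)
      (use disj in \<open>auto simp: sum.reindex[OF inj1] sum.reindex[OF inj2] comp_def\<close>)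
  have "(real (card ?V) / 32) * real N \<le> \<beta> * (\<Sum>e\<in>?E1 \<union> ?E2. ?w e * ?d e)"
  proof (rule lipschitz_duality[OF D])
    show "?E1 \<union> ?E2 \<subseteq> points \<times> points" using crossing_subset by auto
    fix P assume P: "quasipartition points P" "bounded_relation qdist (real N) P"
    let ?c = "\<lambda>e. if e \<in> P then 0 else ?w e"
    have nn: "0 \<le> (\<Sum>v\<in>?V. ?c ((v, False), (v, True)))"
        "0 \<le> (\<Sum>e\<in>crossing. ?c ((fst e, True), (snd e, False)))"
      by (auto intro!: sum_nonneg)
    \<comment> \<open>A single cut crossing already pays for the bound; if none is cut, many
      vertices must be.\<close>
    have "real (card ?V) / 32 \<le> (\<Sum>v\<in>?V. ?c ((v, False), (v, True)))
        + (\<Sum>e\<in>crossing. ?c ((fst e, True), (snd e, False)))"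
    proof (cases "\<forall>(v, w)\<in>crossing. ((v, True), (w, False)) \<in> P")
      case True
      then have "card ?V \<le> 32 * card {v \<in> ?V. ((v, False), (v, True)) \<notin> P}"
        by (intro bounded_quasipartition_cuts P) auto
      then have "real (card ?V) / 32 \<le> real (card {v \<in> ?V. ((v, False), (v, True)) \<notin> P})"
        by linarith
      also have "\<dots> = (\<Sum>v\<in>?V. if ((v, False), (v, True)) \<notin> P then 1 else 0)"
        by (simp add: sum.If_cases Int_def)
      also have "\<dots> = (\<Sum>v\<in>?V. ?c ((v, False), (v, True)))"
        by (intro sum.cong) auto
      finally show ?thesis using nn by linarith
    next
      case False
      then obtain e where e: "e \<in> crossing" "((fst e, True), (snd e, False)) \<notin> P" by auto
      have "real (card ?V) = ?c ((fst e, True), (snd e, False))"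
        using e by simp
      also have "\<dots> \<le> (\<Sum>e\<in>crossing. ?c ((fst e, True), (snd e, False)))"
        by (rule member_le_sum) (use e in auto)
      finally show ?thesis using nn Vpos by linarith
    qed
    then show "real (card ?V) / 32 \<le> (\<Sum>e\<in>?E1 \<union> ?E2. ?c e)" unfolding sum .
  qed (use pos \<beta> dist_real_nonneg in auto)
  also have "\<dots> \<le> \<beta> * (2 * real (card ?V))"
  proof (intro mult_left_mono \<beta>)
    have "(\<Sum>e\<in>?E1 \<union> ?E2. ?w e * ?d e)
        \<le> (\<Sum>v\<in>?V. 1 + \<eta>) + (\<Sum>e\<in>crossing. real (card ?V) * \<eta>)"
      unfolding sum using dist_vertex dist_crossing
      by (intro add_mono sum_mono) (auto intro!: mult_left_mono)
    also have "\<dots> = real (card ?V) * (1 + \<eta> * (real (card crossing) + 1))"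
      by (simp add: algebra_simps)
    also have "\<eta> * (real (card crossing) + 1) = 1"
      unfolding \<eta>_def by (simp add: add_pos_nonneg add_nonneg_eq_0_iff)
    finally show "(\<Sum>e\<in>?E1 \<union> ?E2. ?w e * ?d e) \<le> 2 * real (card ?V)" by simp
  qed
  finally have "real (card ?V) * (real N / 64) \<le> real (card ?V) * \<beta>" by (simp add: mult_ac)
  then show ?thesis using Vpos by simp
qed

end

text \<open>Since \<open>from_nat\<close> inverts \<open>to_nat\<close>, quasipartitions of the
  image pull back to \<open>S\<close>; the pushforward of \<open>D\<close> under this pullback keeps
  all cut probabilities.\<close>

lemma transfer_to_nat:
  fixes S :: "('a::countable) set" and d :: "'a \<Rightarrow> 'a \<Rightarrow> ennreal"
  assumes "quasimetric_space S d"
    and bound: "\<And>D. quasipartition_distribution S d r D \<Longrightarrow> lipschitz_distribution S d r \<beta> D \<Longrightarrow> L \<le> \<beta>"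
  shows "quasimetric_space (to_nat ` S) (\<lambda>m n. d (from_nat m) (from_nat n))"
    and "quasipartition_distribution (to_nat ` S) (\<lambda>m n. d (from_nat m) (from_nat n)) r D \<Longrightarrow>
      lipschitz_distribution (to_nat ` S) (\<lambda>m n. d (from_nat m) (from_nat n)) r \<beta> D \<Longrightarrow> L \<le> \<beta>"
proof -
  interpret quasimetric_space S d by fact
  show "quasimetric_space (to_nat ` S) (\<lambda>m n. d (from_nat m) (from_nat n))"
    by unfold_locales (auto simp: zero triangle)
  let ?d = "\<lambda>m n. d (from_nat m) (from_nat n)"
  let ?h = "\<lambda>P. {(x, y). (to_nat x, to_nat y) \<in> P} :: ('a \<times> 'a) set"
  assume D: "quasipartition_distribution (to_nat ` S) ?d r D" "lipschitz_distribution (to_nat ` S) ?d r \<beta> D"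
  have "quasipartition S (?h P) \<and> bounded_relation d r (?h P)" if "P \<in> set_pmf D" for P
  proof -
    have P: "P \<subseteq> to_nat ` S \<times> to_nat ` S" "refl_on (to_nat ` S) P" "trans P" "bounded_relation ?d r P"
      using D(1) that unfolding quasipartition_distribution_def quasipartition_def by auto
    have "?h P \<subseteq> S \<times> S" using P(1) by auto
    moreover have "refl_on S (?h P)" using P(2) by (auto simp: refl_on_def)
    moreover have "trans (?h P)" using P(3) unfolding trans_def by blast
    moreover have "bounded_relation d r (?h P)"
      using P(4) unfolding bounded_relation_def by force
    ultimately show ?thesis unfolding quasipartition_def by simp
  qed
  then have "quasipartition_distribution S d r (map_pmf ?h D)"
    unfolding quasipartition_distribution_def by auto
  moreover have "lipschitz_distribution S d r \<beta> (map_pmf ?h D)"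
    using D(2) unfolding lipschitz_distribution_def by (auto simp: vimage_def)
  ultimately show "L \<le> \<beta>" by (rule bound)
qed

section \<open>Choice of parameters and the bound in terms of the number of points\<close>

theorem theorem22:
  "\<exists>c::real. c > 0 \<and>
     (\<forall>N::nat. \<exists>n\<ge>N. \<exists>(M :: nat set) (d :: nat \<Rightarrow> nat \<Rightarrow> ennreal) (r :: real).
        finite M \<and> card M = n \<and> quasimetric_space M d \<and> r > 0 \<and>
        (\<forall>(D :: (nat \<times> nat) set pmf) (\<beta> :: real).
           \<beta> \<ge> 0 \<longrightarrow> quasipartition_distribution M d r D \<longrightarrow> lipschitz_distribution M d r \<beta> D \<longrightarrow>
           \<beta> \<ge> c * (real n powr (1/7) / ln (real n) powr (4/7))))"
proof (intro exI[of _ "1 / 4096 :: real"] conjI allI)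
  fix N0 :: nat
  define N where "N = Suc N0"
  define T where "T = 4 * N"
  define b where "b = 8 * N"
  define q where "q = 256 * N"
  have N: "N > 0" unfolding N_def by simp
  obtain \<Lambda> where "robust_labeling N T b q \<Lambda>"
    using exists_robust_labeling[OF N T_def b_def q_def] N
    unfolding robust_labeling_def T_def b_def q_def by (metis (no_types, lifting) mult_pos_pos zero_less_numeral)
  then interpret robust_labeling N T b q \<Lambda> .
  define n where "n = card points"
  have n: "n = 2 ^ 36 * N ^ 7"
    unfolding n_def card_cartesian_product card_vertices T_def b_def q_def
    by (simp add: power_mult_distrib power_numeral_reduce mult_ac)
  have big: "N \<le> n" "3 \<le> n"
  proof -
    have "N ^ 1 \<le> N ^ 7" "1 \<le> N ^ 7" using N by (intro power_increasing, auto)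
    then show "N \<le> n" "3 \<le> n" unfolding n by auto
  qed
  let ?M = "to_nat ` points" and ?d = "\<lambda>m m'. qdist (from_nat m) (from_nat m')"
  \<comment> \<open>The logarithm is at least \<open>1\<close> as \<open>n \<ge> 3\<close>, and
    \<open>n = 2 ^ 36 * N ^ 7 \<le> (64 * N) ^ 7\<close>. Hence the constant
    \<open>1 / 4096 = 1 / 64 * (1 / 64)\<close>.\<close>
  have rate: "1 / 4096 * (real n powr (1/7) / ln (real n) powr (4/7)) \<le> real N / 64"
  proof -
    have "exp 1 \<le> real n" using e_less_272 big(2) by simp
    then have "1 \<le> ln (real n)" using big(2) by (simp add: ln_ge_iff)
    then have "1 \<le> ln (real n) powr (4/7)" by (simp add: ge_one_powr_ge_zero)
    then have "real n powr (1/7) / ln (real n) powr (4/7) \<le> real n powr (1/7)"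
      by (simp add: divide_le_eq mult_le_cancel_left1)
    also have "\<dots> \<le> ((2 ^ 6 * real N) powr 7) powr (1/7)"
    proof (rule powr_mono2)
      have "real n \<le> (2 ^ 6 * real N) ^ 7" unfolding n by (simp add: power_mult_distrib)
      then show "real n \<le> (2 ^ 6 * real N) powr 7" using N by (simp add: powr_numeral)
    qed auto
    also have "\<dots> = 64 * real N" unfolding powr_powr using N by simp
    finally show ?thesis by simp
  qed
  have bound: "real N / 64 \<le> \<beta>" if "\<beta> \<ge> 0" "quasipartition_distribution ?M ?d (real N) D"
      "lipschitz_distribution ?M ?d (real N) \<beta> D" for D \<beta>
    by (rule transfer_to_nat(2)[OF quasimetric_points lipschitz_bound that(2,3)]) (use that(1) in auto)
  have M: "finite ?M" "card ?M = n" "quasimetric_space ?M ?d"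
    using transfer_to_nat(1)[OF quasimetric_points] card_image[of to_nat points]
    unfolding n_def by (auto intro: inj_on_subset[OF inj_to_nat])
  have all: "\<forall>(D :: (nat \<times> nat) set pmf) (\<beta> :: real).
      \<beta> \<ge> 0 \<longrightarrow> quasipartition_distribution ?M ?d (real N) D \<longrightarrow> lipschitz_distribution ?M ?d (real N) \<beta> D \<longrightarrow>
      \<beta> \<ge> 1 / 4096 * (real n powr (1/7) / ln (real n) powr (4/7))"
    using bound order_trans[OF rate] by blast
  have "N0 \<le> n" "real N > 0" using big(1) N unfolding N_def by auto
  with M all show "\<exists>n\<ge>N0. \<exists>(M :: nat set) (d :: nat \<Rightarrow> nat \<Rightarrow> ennreal) (r :: real).
        finite M \<and> card M = n \<and> quasimetric_space M d \<and> r > 0 \<and>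
        (\<forall>(D :: (nat \<times> nat) set pmf) (\<beta> :: real).
           \<beta> \<ge> 0 \<longrightarrow> quasipartition_distribution M d r D \<longrightarrow> lipschitz_distribution M d r \<beta> D \<longrightarrow>
           \<beta> \<ge> 1 / 4096 * (real n powr (1/7) / ln (real n) powr (4/7)))"
    by (intro exI[of _ n] conjI exI[of _ ?M] exI[of _ ?d] exI[of _ "real N"])
qed simp

end
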